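(* When the no-show probabilities are not all equal, the loss of the DPD policy can be of order $\Omega(T)$. That is: there exist a number of types $k$ and fixed type parameters $(\lambda_j,v_j,p_j)_{j\in[k]}$ with $p_1,\dots,p_k$ not all equal, a sequence of capacities $B=B_T\in\mathbb N$, and constants $c>0$ and $T_0$, such that for all $T\ge T_0$, $$\mathbb E\left[\widehat{\mathrm{OPT}}_{\vec A}-\mathrm{DPD}_{\vec A}\right]\ge c\,T,$$ where $\widehat{\mathrm{OPT}}_{\vec A}$ is the clairvoyant optimal objective and $\mathrm{DPD}_{\vec A}$ is the objective of the DPD policy, on the instance with horizon $T$ and capacity $B_T$ (the expectation is over the arrivals $\vec A$ and the policy's simulation).
   Context: **Model.** $[k]=\{1,\dots,k\}$, $\mathbb N=\{0,1,2,\dots\}$. There are $k$ customer types; type $j$ has arrival probability $\lambda_j>0$ ($\sum_j\lambda_j=1$), revenue $v_j\in[0,1)$, and show-up probability $p_j\in[0,1]$. Capacity $B\in\mathbb N$, horizon $T$. Arrivals $\vec A=(A_1,\dots,A_T)$ are i.i.d. with $\mathbb P[A_t=j]=\lambda_j$; each arrival is irrevocably accepted or rejected on arrival. If $\vec x\in\mathbb N^k$ customers are accepted in total, the objective is $\sum_jv_jx_j-\mathbb E\big[\big(\sum_j X_{j,x_j}-B\big)^+\big]$ with $X_{j,x_j}\sim\mathrm{Bin}(x_j,p_j)$ independent. $\widehat{\mathrm{OPT}}_{\vec A}$ is the maximum of this objective over integer $\vec x$ with $0\le x_j\le N_j$, where $N_j$ is the number of type $j$ arrivals in $\vec A$. **DLP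 policy.** Consider the linear program: maximize $\sum_jv_jz_j-\sum_jw_j$ subject to $\sum_j(p_jz_j-w_j)\le B$; $z_j\le T\lambda_j$, $w_j\le p_jz_j$, and $z_j,w_j\ge0$ for all $j$. Let $\Pi^\star$ be the optimal dual value of the constraint $\sum_j(p_jz_j-w_j)\le B$. The DLP policy accepts an arriving customer of type $j$ if and only if $v_j\ge p_j\Pi^\star$. **DPD policy.** Simulate the DLP policy on $M\ge1$ independent realizations of the arrival sequence ($M$ fixed); let $x_j^m$ be the number of type $j$ customers accepted in the $m$-th realization and set $\alpha_j=\big(\sum_{m=1}^Mx_j^m\big)/\big(\sum_{m=1}^M\sum_{j'}x_{j'}^m\big)$. For $x\in\mathbb N$ let $\Gamma_{\vec\alpha}(x)$ be the sum of $k$ independent random variables, the $j$-th of which is distributed as $\mathrm{Bin}(\lfloor x\alpha_j\rfloor,p_j)$ with probability $\lfloor x\alpha_j\rfloor+1-x\alpha_j$ and as $\mathrm{Bin}(\lceil x\alpha_j\rceil,p_j)$ otherwise. Define $U_{T+1}(x)=-\mathbb E[(\Gamma_{\vec\alpha}(x)-B)^+]$ and, for $t\le T$, $U_t(x)=\sum_{j=1}^k\lambda_j\max\{v_j+U_{t+1}(x+1),\,U_{t+1}(x)\}$. The DPD policy, in period $t$, having accepted $x$ customers so far in total, accepts an arriving customer of type $j$ if and only if $v_j\ge U_{t+1}(x)-U_{t+1}(x+1)$. $\mathrm{DPD}_{\vec A}$ is the objective of the resulting vector of accepted customers. *)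

theory Defs
  imports "HOL-Probability.Probability"
begin

text \<open>
  Customer types are \<open>1, \<dots>, k\<close>; families indexed by types are functions on \<open>nat\<close> of which only the
  values on \<open>{1..k}\<close> are relevant. The arrival probabilities are given as a \<open>pmf\<close>, so
  \<open>\<lambda>\<^sub>j = pmf lam j\<close> and the support condition says that \<open>\<lambda>\<^sub>j > 0\<close> for \<open>j \<in> {1..k}\<close> and that these
  numbers sum to 1.
\<close>

definition valid_types :: "nat \<Rightarrow> nat pmf \<Rightarrow> (nat \<Rightarrow> real) \<Rightarrow> (nat \<Rightarrow> real) \<Rightarrow> bool" where
  "valid_types k lam v p \<longleftrightarrow>
     set_pmf lam = {1..k} \<and>
     (\<forall>j\<in>{1..k}. 0 \<le> v j \<and> v j < 1 \<and> 0 \<le> p j \<and> p j \<le> 1)"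

definition arrivals :: "nat pmf \<Rightarrow> nat \<Rightarrow> nat list pmf" where
  "arrivals lam T = replicate_pmf T lam"

definition objective ::
    "nat \<Rightarrow> (nat \<Rightarrow> real) \<Rightarrow> (nat \<Rightarrow> real) \<Rightarrow> nat \<Rightarrow> (nat \<Rightarrow> nat) \<Rightarrow> real" where
  "objective k v p B x =
     (\<Sum>j=1..k. v j * real (x j)) -
     measure_pmf.expectation (Pi_pmf {1..k} 0 (\<lambda>j. binomial_pmf (x j) (p j)))
       (\<lambda>X. max 0 ((\<Sum>j=1..k. real (X j)) - real B))"

definition opt_hat ::
    "nat \<Rightarrow> (nat \<Rightarrow> real) \<Rightarrow> (nat \<Rightarrow> real) \<Rightarrow> nat \<Rightarrow> nat list \<Rightarrow> real" where
  "opt_hat k v p B A = Max (objective k v p B ` (\<Pi>\<^sub>E j\<in>{1..k}. {0..count_list A j}))"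

definition dlp_feasible ::
    "nat \<Rightarrow> nat pmf \<Rightarrow> (nat \<Rightarrow> real) \<Rightarrow> nat \<Rightarrow> nat \<Rightarrow> (nat \<Rightarrow> real) \<Rightarrow> (nat \<Rightarrow> real) \<Rightarrow> bool" where
  "dlp_feasible k lam p B T z w \<longleftrightarrow>
     (\<Sum>j=1..k. p j * z j - w j) \<le> real B \<and>
     (\<forall>j\<in>{1..k}. z j \<le> real T * pmf lam j \<and> w j \<le> p j * z j \<and> 0 \<le> z j \<and> 0 \<le> w j)"

definition dlp_value :: "nat \<Rightarrow> (nat \<Rightarrow> real) \<Rightarrow> (nat \<Rightarrow> real) \<Rightarrow> (nat \<Rightarrow> real) \<Rightarrow> real" where
  "dlp_value k v z w = (\<Sum>j=1..k. v j * z j) - (\<Sum>j=1..k. w j)"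

text \<open>
  The linear programming dual. The multipliers are \<open>\<pi>\<close> for the capacity constraint, \<open>y j\<close> for
  \<open>z j \<le> T * \<lambda>\<^sub>j\<close> and \<open>u j\<close> for \<open>w j - p j * z j \<le> 0\<close>; the two inequalities in the second line
  belong to the columns \<open>z j\<close> and \<open>w j\<close>.
\<close>

definition dlp_dual_feasible ::
    "nat \<Rightarrow> (nat \<Rightarrow> real) \<Rightarrow> (nat \<Rightarrow> real) \<Rightarrow> real \<Rightarrow> (nat \<Rightarrow> real) \<Rightarrow> (nat \<Rightarrow> real) \<Rightarrow> bool" where
  "dlp_dual_feasible k v p \<pi> y u \<longleftrightarrow>
     0 \<le> \<pi> \<and> (\<forall>j\<in>{1..k}. 0 \<le> y j \<and> 0 \<le> u j \<and>
       v j \<le> p j * \<pi> + y j - p j * u j \<and> - 1 \<le> u j - \<pi>)"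

definition dlp_dual_value ::
    "nat \<Rightarrow> nat pmf \<Rightarrow> nat \<Rightarrow> nat \<Rightarrow> real \<Rightarrow> (nat \<Rightarrow> real) \<Rightarrow> real" where
  "dlp_dual_value k lam B T \<pi> y = real B * \<pi> + (\<Sum>j=1..k. real T * pmf lam j * y j)"

text \<open>The optimal dual value of the capacity constraint need not be unique, hence a predicate.\<close>

definition dlp_price ::
    "nat \<Rightarrow> nat pmf \<Rightarrow> (nat \<Rightarrow> real) \<Rightarrow> (nat \<Rightarrow> real) \<Rightarrow> nat \<Rightarrow> nat \<Rightarrow> real \<Rightarrow> bool" where
  "dlp_price k lam v p B T \<pi> \<longleftrightarrow>
     (\<exists>y u. dlp_dual_feasible k v p \<pi> y u \<and>
        (\<forall>\<pi>' y' u'. dlp_dual_feasible k v p \<pi>' y' u' \<longrightarrow>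
           dlp_dual_value k lam B T \<pi> y \<le> dlp_dual_value k lam B T \<pi>' y'))"

lemma dlp_weak_duality:
  assumes P: "dlp_feasible k lam p B T z w" and D: "dlp_dual_feasible k v p \<pi> y u"
  shows "dlp_value k v z w \<le> dlp_dual_value k lam B T \<pi> y"
proof -
  have "v j * z j - w j \<le> \<pi> * (p j * z j - w j) + real T * pmf lam j * y j"
    if j: "j \<in> {1..k}" for j
  proof -
    have "v j * z j \<le> (p j * \<pi> + y j - p j * u j) * z j"
      using P D j by (intro mult_right_mono) (auto simp: dlp_feasible_def dlp_dual_feasible_def)
    moreover have "(\<pi> - 1) * w j \<le> u j * w j"
    proof (rule mult_right_mono)
      have "- 1 \<le> u j - \<pi>" using D j by (simp add: dlp_dual_feasible_def)
      then show "\<pi> - 1 \<le> u j" by linarith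
      show "0 \<le> w j" using P j by (simp add: dlp_feasible_def)
    qed
    moreover have "u j * w j \<le> u j * (p j * z j)"
      using P D j by (intro mult_left_mono) (auto simp: dlp_feasible_def dlp_dual_feasible_def)
    moreover have "z j * y j \<le> real T * pmf lam j * y j"
      using P D j by (intro mult_right_mono) (auto simp: dlp_feasible_def dlp_dual_feasible_def)
    ultimately show ?thesis by (simp add: algebra_simps)
  qed
  then have "(\<Sum>j=1..k. v j * z j - w j) \<le>
      (\<Sum>j=1..k. \<pi> * (p j * z j - w j) + real T * pmf lam j * y j)"
    by (rule sum_mono)
  also have "\<dots> = \<pi> * (\<Sum>j=1..k. p j * z j - w j) + (\<Sum>j=1..k. real T * pmf lam j * y j)"
    by (simp only: sum.distrib sum_distrib_left)
  also have "\<pi> * (\<Sum>j=1..k. p j * z j - w j) \<le> \<pi> * real B"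
    using P D by (intro mult_left_mono) (auto simp: dlp_feasible_def dlp_dual_feasible_def)
  finally show ?thesis
    by (simp add: dlp_value_def dlp_dual_value_def sum_subtractf mult.commute)
qed

lemma dlp_price_exists:
  assumes p: "\<And>j. j \<in> {1..k} \<Longrightarrow> 0 \<le> p j"
  shows "\<exists>\<pi>. dlp_price k lam v p B T \<pi>"
proof -
  define Y where "Y = (\<lambda>\<pi> j. max 0 (v j - p j * \<pi>))"
  define \<phi> where "\<phi> = (\<lambda>\<pi>. dlp_dual_value k lam B T \<pi> (Y \<pi>))"
  have "continuous_on {0..1} \<phi>"
    unfolding \<phi>_def dlp_dual_value_def Y_def by (intro continuous_intros)
  then obtain m where m: "m \<in> {0..1}" and min: "\<And>x. x \<in> {0..1} \<Longrightarrow> \<phi> m \<le> \<phi> x"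
    using continuous_attains_inf[of "{0..1::real}" \<phi>] by auto
  have "dlp_dual_feasible k v p m (Y m) (\<lambda>_. 0)"
    using m by (auto simp: dlp_dual_feasible_def Y_def)
  moreover have "dlp_dual_value k lam B T m (Y m) \<le> dlp_dual_value k lam B T \<pi> y"
    if D: "dlp_dual_feasible k v p \<pi> y u" for \<pi> y u
  proof -
    have \<pi>: "0 \<le> \<pi>" using D by (simp add: dlp_dual_feasible_def)
    have "Y (min \<pi> 1) j \<le> y j" if j: "j \<in> {1..k}" for j
    proof -
      have "- 1 \<le> u j - \<pi>" "0 \<le> u j" using D j by (auto simp: dlp_dual_feasible_def)
      then have "\<pi> - u j \<le> min \<pi> 1" by linarith
      then have "p j * (\<pi> - u j) \<le> p j * min \<pi> 1"
        using p[OF j] by (rule mult_left_mono)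
      moreover have "v j \<le> p j * \<pi> + y j - p j * u j" "0 \<le> y j"
        using D j by (auto simp: dlp_dual_feasible_def)
      ultimately show ?thesis by (simp add: Y_def right_diff_distrib)
    qed
    then have "(\<Sum>j=1..k. real T * pmf lam j * Y (min \<pi> 1) j) \<le> (\<Sum>j=1..k. real T * pmf lam j * y j)"
      by (intro sum_mono mult_left_mono) auto
    moreover have "real B * min \<pi> 1 \<le> real B * \<pi>"
      by (intro mult_left_mono) auto
    ultimately have "\<phi> (min \<pi> 1) \<le> dlp_dual_value k lam B T \<pi> y"
      by (simp add: \<phi>_def dlp_dual_value_def)
    with min[of "min \<pi> 1"] \<pi> show ?thesis by (simp add: \<phi>_def)
  qed
  ultimately show ?thesis unfolding dlp_price_def by blast
qed

definition dlp_accepted ::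
    "(nat \<Rightarrow> real) \<Rightarrow> (nat \<Rightarrow> real) \<Rightarrow> real \<Rightarrow> nat list \<Rightarrow> nat \<Rightarrow> nat" where
  "dlp_accepted v p \<pi> A j = count_list (filter (\<lambda>i. v i \<ge> p i * \<pi>) A) j"

text \<open>
  If no customer is accepted in any simulated sequence, the quotient below is \<open>0 / 0 = 0\<close>.
\<close>

definition mix ::
    "nat \<Rightarrow> (nat \<Rightarrow> real) \<Rightarrow> (nat \<Rightarrow> real) \<Rightarrow> real \<Rightarrow> nat list list \<Rightarrow> nat \<Rightarrow> real" where
  "mix k v p \<pi> As j =
     real (\<Sum>A\<leftarrow>As. dlp_accepted v p \<pi> A j) /
     real (\<Sum>A\<leftarrow>As. \<Sum>i=1..k. dlp_accepted v p \<pi> A i)"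

definition rounded_binomial_pmf :: "real \<Rightarrow> real \<Rightarrow> nat pmf" where
  "rounded_binomial_pmf y q =
     do {
       down \<leftarrow> bernoulli_pmf (of_int \<lfloor>y\<rfloor> + 1 - y);
       binomial_pmf (if down then nat \<lfloor>y\<rfloor> else nat \<lceil>y\<rceil>) q
     }"

definition Gamma_pmf ::
    "nat \<Rightarrow> (nat \<Rightarrow> real) \<Rightarrow> (nat \<Rightarrow> real) \<Rightarrow> nat \<Rightarrow> nat pmf" where
  "Gamma_pmf k p \<alpha> x =
     map_pmf (\<lambda>X. \<Sum>j=1..k. X j)
       (Pi_pmf {1..k} 0 (\<lambda>j. rounded_binomial_pmf (real x * \<alpha> j) (p j)))"

text \<open>
  The dynamic program is indexed by the number \<open>n\<close> of periods to go: with horizon \<open>T\<close>, the value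
  function usually written \<open>U\<^sub>t(x)\<close> is \<open>dp_value \<dots> (T + 1 - t) x\<close>.
\<close>

primrec dp_value ::
    "nat \<Rightarrow> nat pmf \<Rightarrow> (nat \<Rightarrow> real) \<Rightarrow> (nat \<Rightarrow> real) \<Rightarrow> nat \<Rightarrow> (nat \<Rightarrow> real) \<Rightarrow> nat \<Rightarrow> nat \<Rightarrow> real"
where
  "dp_value k lam v p B \<alpha> 0 x =
     - measure_pmf.expectation (Gamma_pmf k p \<alpha> x) (\<lambda>g. max 0 (real g - real B))"
| "dp_value k lam v p B \<alpha> (Suc n) x =
     (\<Sum>j=1..k. pmf lam j *
        max (v j + dp_value k lam v p B \<alpha> n (x + 1)) (dp_value k lam v p B \<alpha> n x))"

text \<open>
  \<open>threshold_run v V A x\<close> lists the types accepted out of the remaining arrivals \<open>A\<close> when \<open>x\<close> customers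
  have been accepted before. In period \<open>t\<close> the number of periods after the current one,
  \<open>length as\<close>, is \<open>T - t\<close>, so that \<open>V (length as)\<close> is \<open>U\<^sub>t\<^sub>+\<^sub>1\<close> for \<open>V = dp_value \<dots>\<close>.
\<close>

primrec threshold_run ::
    "(nat \<Rightarrow> real) \<Rightarrow> (nat \<Rightarrow> nat \<Rightarrow> real) \<Rightarrow> nat list \<Rightarrow> nat \<Rightarrow> nat list"
where
  "threshold_run v V [] x = []"
| "threshold_run v V (a # as) x =
     (if v a \<ge> V (length as) x - V (length as) (x + 1)
      then a # threshold_run v V as (x + 1)
      else threshold_run v V as x)"

definition dpd ::
    "nat \<Rightarrow> nat pmf \<Rightarrow> (nat \<Rightarrow> real) \<Rightarrow> (nat \<Rightarrow> real) \<Rightarrow> nat \<Rightarrow> real \<Rightarrow> nat list list \<Rightarrow> nat list \<Rightarrow> real"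
where
  "dpd k lam v p B \<pi> As A =
     objective k v p B
       (count_list (threshold_run v (dp_value k lam v p B (mix k v p \<pi> As)) A 0))"

text \<open>Here \<open>\<pi>\<close> is the price used in the simulations \<open>As\<close>, which are independent of the arrivals \<open>A\<close>.\<close>

definition dpd_expected_loss ::
    "nat \<Rightarrow> nat pmf \<Rightarrow> (nat \<Rightarrow> real) \<Rightarrow> (nat \<Rightarrow> real) \<Rightarrow> nat \<Rightarrow> nat \<Rightarrow> nat \<Rightarrow> real \<Rightarrow> real" where
  "dpd_expected_loss k lam v p B T M \<pi> =
     measure_pmf.expectation
       (pair_pmf (arrivals lam T) (replicate_pmf M (arrivals lam T)))
       (\<lambda>(A, As). opt_hat k v p B A - dpd k lam v p B \<pi> As A)"

end

theory Submission
  imports Defs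
begin

text \<open>
  With capacity \<open>B = 0\<close> every show-up costs 1, so the objective is the linear function
  \<open>\<Sum>j. (v j - p j) * x j\<close> and the dynamic program has value \<open>- q * x\<close> plus a constant, where
  \<open>q = \<Sum>j. \<alpha> j * p j\<close> is the average show-up probability of the simulated mix: the DPD policy
  accepts type \<open>j\<close> iff \<open>v j \<ge> q\<close>, whereas it is profitable iff \<open>v j \<ge> p j\<close>. Take two equally likely
  types with \<open>v = (1/2, 1/2)\<close> and \<open>p = (1/4, 1)\<close>. Since \<open>v 1 > p 1\<close>, all optimal dual prices are at
  least 1, so the simulated DLP policy never accepts type 2 and \<open>q \<le> 1/4\<close>. Hence the DPD policy
  accepts everybody and loses 1/2 on each of the about \<open>T/2\<close> customers of type 2.
\<close>

section \<open>Means of binomial and randomly rounded binomial variables\<close>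

lemma expectation_binomial_pmf:
  assumes "q \<in> {0..1}"
  shows "measure_pmf.expectation (binomial_pmf n q) real = real n * q"
proof (induction n)
  case 0
  then show ?case using assms by (simp add: binomial_pmf_0)
next
  case (Suc n)
  have int: "integrable (measure_pmf (binomial_pmf n q)) f" for f :: "nat \<Rightarrow> real"
    using assms by (intro integrable_measure_pmf_finite) auto
  have "measure_pmf.expectation (binomial_pmf (Suc n) q) real =
      q * measure_pmf.expectation (binomial_pmf n q) (\<lambda>x. 1 + real x) +
      (1 - q) * measure_pmf.expectation (binomial_pmf n q) real"
    unfolding binomial_pmf_Suc[OF assms] map_pmf_def[symmetric] using assms
    by (subst pmf_expectation_bind[where A = UNIV]) (auto simp: UNIV_bool int intro!: finite_imageI)
  also have "\<dots> = real (Suc n) * q"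
    using int[of real] Suc.IH by (simp add: algebra_simps)
  finally show ?case .
qed

lemma finite_set_rounded_binomial_pmf:
  assumes "q \<in> {0..1}"
  shows "finite (set_pmf (rounded_binomial_pmf y q))"
  using assms by (auto simp: rounded_binomial_pmf_def)

text \<open>Rounding \<open>y\<close> randomly to a neighbouring integer is unbiased, which makes
  the mean of \<open>Gamma_pmf\<close> exactly linear in \<open>x\<close>.\<close>

lemma expectation_rounded_binomial_pmf:
  assumes "q \<in> {0..1}" and "y \<ge> 0"
  shows "measure_pmf.expectation (rounded_binomial_pmf y q) real = y * q"
proof -
  define r where "r = of_int \<lfloor>y\<rfloor> + 1 - y"
  have r: "0 \<le> r" "r \<le> 1" unfolding r_def by linarith+
  have fl: "real (nat \<lfloor>y\<rfloor>) = of_int \<lfloor>y\<rfloor>" and ce: "real (nat \<lceil>y\<rceil>) = of_int \<lceil>y\<rceil>"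
    using assms(2) by auto
  have "measure_pmf.expectation (rounded_binomial_pmf y q) real =
      r * (of_int \<lfloor>y\<rfloor> * q) + (1 - r) * (of_int \<lceil>y\<rceil> * q)"
    using assms r unfolding rounded_binomial_pmf_def r_def[symmetric]
    by (subst pmf_expectation_bind[where A = UNIV])
      (auto simp: UNIV_bool expectation_binomial_pmf fl ce)
  also have "\<dots> = (r * of_int \<lfloor>y\<rfloor> + (1 - r) * of_int \<lceil>y\<rceil>) * q"
    by (simp add: algebra_simps)
  also have "r * of_int \<lfloor>y\<rfloor> + (1 - r) * of_int \<lceil>y\<rceil> = y"
  \<comment> \<open>At an integer, floor and ceiling coincide; elsewhere they differ by 1.\<close>
  proof (cases "y \<in> \<int>")
    case True
    then show ?thesis by (auto simp: r_def elim!: Ints_cases)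
  next
    case False
    then have "\<lceil>y\<rceil> = \<lfloor>y\<rfloor> + 1" by (simp add: ceiling_altdef) (metis Ints_of_int)
    then show ?thesis by (simp add: r_def algebra_simps)
  qed
  finally show ?thesis .
qed

section \<open>Linearity of objective and dynamic program at capacity 0\<close>

text \<open>The number of show-ups is nonnegative, so at capacity 0 the positive part disappears and
  linearity of expectation applies.\<close>

lemma objective_zero_capacity:
  assumes p: "\<And>j. j \<in> {1..k} \<Longrightarrow> p j \<in> {0..1}"
  shows "objective k v p 0 x = (\<Sum>j=1..k. (v j - p j) * real (x j))"
proof -
  have "measure_pmf.expectation (Pi_pmf {1..k} 0 (\<lambda>j. binomial_pmf (x j) (p j)))
      (\<lambda>X. \<Sum>j=1..k. real (X j)) = (\<Sum>j=1..k. real (x j) * p j)"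
    using p by (subst expectation_sum_Pi_pmf)
      (auto intro!: integrable_measure_pmf_finite sum.cong expectation_binomial_pmf)
  then show ?thesis
    by (simp add: objective_def sum_nonneg max_def left_diff_distrib sum_subtractf
        mult.commute[of _ "p _"])
qed

lemma expectation_Gamma_pmf:
  assumes p: "\<And>j. j \<in> {1..k} \<Longrightarrow> p j \<in> {0..1}" and \<alpha>: "\<And>j. j \<in> {1..k} \<Longrightarrow> \<alpha> j \<ge> 0"
  shows "measure_pmf.expectation (Gamma_pmf k p \<alpha> x) real = real x * (\<Sum>j=1..k. \<alpha> j * p j)"
proof -
  have "measure_pmf.expectation (Gamma_pmf k p \<alpha> x) real =
      (\<Sum>j=1..k. measure_pmf.expectation (rounded_binomial_pmf (real x * \<alpha> j) (p j)) real)"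
    unfolding Gamma_pmf_def integral_map_pmf of_nat_sum
    using p by (subst expectation_sum_Pi_pmf)
      (auto intro!: integrable_measure_pmf_finite finite_set_rounded_binomial_pmf)
  also have "\<dots> = (\<Sum>j=1..k. real x * \<alpha> j * p j)"
    using p \<alpha> by (intro sum.cong expectation_rounded_binomial_pmf) auto
  finally show ?thesis by (simp add: sum_distrib_left mult.assoc)
qed

text \<open>The terminal value has slope \<open>-q\<close>. The recursion preserves this, since
  lowering both arguments of \<open>max\<close> by \<open>q\<close> lowers the maximum by
  \<open>q\<close> and the weights sum to 1. Hence the acceptance threshold is \<open>q\<close> in
  every period and state.\<close>

lemma dp_value_zero_capacity_diff:
  assumes p: "\<And>j. j \<in> {1..k} \<Longrightarrow> p j \<in> {0..1}" and \<alpha>: "\<And>j. j \<in> {1..k} \<Longrightarrow> \<alpha> j \<ge> 0"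
    and lam: "set_pmf lam = {1..k}"
  shows "dp_value k lam v p 0 \<alpha> n x - dp_value k lam v p 0 \<alpha> n (x + 1) = (\<Sum>j=1..k. \<alpha> j * p j)"
proof (induction n arbitrary: x)
  case 0
  show ?case
    using expectation_Gamma_pmf[of k p \<alpha>, OF p \<alpha>] by (simp add: algebra_simps)
next
  case (Suc n)
  let ?V = "dp_value k lam v p 0 \<alpha>" and ?q = "\<Sum>j=1..k. \<alpha> j * p j"
  have step: "?V n (y + 1) = ?V n y - ?q" for y
    using Suc.IH[of y] by simp
  have "?V (Suc n) (x + 1) = (\<Sum>j=1..k. pmf lam j * (max (v j + ?V n (x + 1)) (?V n x) - ?q))"
    unfolding dp_value.simps step[of "x + 1"] step[of x] by (intro sum.cong) auto
  also have "\<dots> = ?V (Suc n) x - (\<Sum>j=1..k. pmf lam j) * ?q"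
    by (simp add: right_diff_distrib sum_subtractf sum_distrib_right)
  also have "(\<Sum>j=1..k. pmf lam j) = 1"
    using lam by (intro sum_pmf_eq_1) auto
  finally show ?case by simp
qed

lemma threshold_run_accept_all:
  assumes "\<And>n x a. a \<in> set A \<Longrightarrow> V n x - V n (x + 1) \<le> v a"
  shows "threshold_run v V A x = A"
  using assms by (induction A arbitrary: x) auto

lemma opt_hat_ge:
  assumes "x \<in> (\<Pi>\<^sub>E j\<in>{1..k}. {0..count_list A j})"
  shows "objective k v p B x \<le> opt_hat k v p B A"
  unfolding opt_hat_def using assms by (intro Max_ge finite_imageI finite_PiE) auto

section \<open>Expected arrival counts\<close>

lemma finite_set_arrivals: "finite (set_pmf lam) \<Longrightarrow> finite (set_pmf (arrivals lam T))"
  by (simp add: arrivals_def set_replicate_pmf lists_eq_set finite_lists_length_eq)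

lemma expectation_count_arrivals:
  assumes fin: "finite (set_pmf lam)"
  shows "measure_pmf.expectation (arrivals lam T) (\<lambda>A. real (count_list A j)) = real T * pmf lam j"
proof (induction T)
  case 0
  then show ?case by (simp add: arrivals_def)
next
  case (Suc T)
  let ?E = "\<lambda>f. measure_pmf.expectation (arrivals lam T) f"
  have int: "integrable (measure_pmf (arrivals lam T)) f" for f :: "nat list \<Rightarrow> real"
    using fin by (intro integrable_measure_pmf_finite finite_set_arrivals)
  have 1: "(\<Sum>a\<in>set_pmf lam. pmf lam a) = 1"
    using fin by (intro sum_pmf_eq_1) auto
  have 2: "(\<Sum>a\<in>set_pmf lam. pmf lam a * of_bool (a = j)) = pmf lam j"
    using fin by (simp add: of_bool_def if_distrib sum.If_cases set_pmf_iff cong: if_cong)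
  have "measure_pmf.expectation (arrivals lam (Suc T)) (\<lambda>A. real (count_list A j)) =
      (\<Sum>a\<in>set_pmf lam. pmf lam a * ?E (\<lambda>A. real (count_list (a # A) j)))"
    using fin finite_set_arrivals[OF fin, of T]
    by (simp add: arrivals_def pmf_expectation_bind[where A = "set_pmf lam"] map_pmf_def[symmetric]
        del: count_list.simps)
  also have "\<dots> = (\<Sum>a\<in>set_pmf lam. pmf lam a * (of_bool (a = j) + ?E (\<lambda>A. real (count_list A j))))"
    using int[of "\<lambda>A. real (count_list A j)"] by (intro sum.cong) auto
  also have "\<dots> = real (Suc T) * pmf lam j"
    by (simp add: Suc.IH distrib_left sum.distrib 1 2 flip: sum_distrib_right)
      (simp add: algebra_simps)
  finally show ?case .
qed

section \<open>The two-type instance\<close>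

definition bad_lam :: "nat pmf" where
  "bad_lam = pmf_of_set {1, 2}"

definition bad_v :: "nat \<Rightarrow> real" where
  "bad_v j = 1 / 2"

definition bad_p :: "nat \<Rightarrow> real" where
  "bad_p j = (if j = 1 then 1 / 4 else 1)"

lemma types_eq: "{Suc 0..2} = {Suc 0, 2}"
  by auto

lemma set_bad_lam: "set_pmf bad_lam = {1..2}"
  by (simp add: bad_lam_def types_eq)

lemma pmf_bad_lam: "j \<in> {1, 2} \<Longrightarrow> pmf bad_lam j = 1 / 2"
  by (auto simp: bad_lam_def)

lemma bad_p_bounds: "bad_p j \<in> {0..1}"
  by (simp add: bad_p_def)

text \<open>At capacity 0 the price is free in the dual objective, so optimality forces
  \<open>y 1 + y 2\<close> down to \<open>1 / 4\<close>; the dual constraint for column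
  \<open>z 1\<close> then needs \<open>\<pi> / 4\<close> to be at least
  \<open>1 / 4\<close>.\<close>

lemma bad_price_ge_1:
  assumes "dlp_price 2 bad_lam bad_v bad_p 0 T \<pi>" and T: "T \<ge> 1"
  shows "\<pi> \<ge> 1"
proof -
  obtain y u where D: "dlp_dual_feasible 2 bad_v bad_p \<pi> y u"
    and opt: "\<And>\<pi>' y' u'. dlp_dual_feasible 2 bad_v bad_p \<pi>' y' u' \<Longrightarrow>
      dlp_dual_value 2 bad_lam 0 T \<pi> y \<le> dlp_dual_value 2 bad_lam 0 T \<pi>' y'"
    using assms(1) unfolding dlp_price_def by blast
  \<comment> \<open>For price 1 and \<open>u = 0\<close>, the cheapest \<open>y j\<close> is the
    positive part of \<open>v j - p j\<close>.\<close>
  have "dlp_dual_feasible 2 bad_v bad_p 1 (\<lambda>j. if j = 1 then 1 / 4 else 0) (\<lambda>_. 0)"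
    by (auto simp: dlp_dual_feasible_def bad_v_def bad_p_def)
  from opt[OF this] have "real T * (y 1 + y 2) \<le> real T * (1 / 4)"
    by (simp add: dlp_dual_value_def types_eq pmf_bad_lam algebra_simps)
  then have "y 1 + y 2 \<le> 1 / 4"
    using T by (subst (asm) mult_le_cancel_left_pos) auto
  moreover have "0 \<le> y 2" "0 \<le> u 1" "1 / 2 \<le> \<pi> / 4 + y 1 - u 1 / 4"
    using D by (auto simp: dlp_dual_feasible_def bad_v_def bad_p_def types_eq)
  ultimately show ?thesis by linarith
qed

lemma bad_mix:
  assumes "\<pi> \<ge> 1"
  shows "mix 2 bad_v bad_p \<pi> As 2 = 0" "mix 2 bad_v bad_p \<pi> As 1 \<le> 1"
proof -
  have 0: "dlp_accepted bad_v bad_p \<pi> A 2 = 0" for A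
    using assms by (simp add: dlp_accepted_def bad_v_def bad_p_def count_list_0_iff)
  then show "mix 2 bad_v bad_p \<pi> As 2 = 0"
    by (simp add: mix_def)
  \<comment> \<open>The quotient is 1, or \<open>0 / 0 = 0\<close> if the simulations accept nobody;
    hence an inequality.\<close>
  show "mix 2 bad_v bad_p \<pi> As 1 \<le> 1"
    using 0 by (simp add: mix_def types_eq divide_le_eq_1)
qed

lemma bad_dpd:
  assumes "\<pi> \<ge> 1"
  shows "dpd 2 bad_lam bad_v bad_p 0 \<pi> As A = real (count_list A 1) / 4 - real (count_list A 2) / 2"
proof -
  let ?\<alpha> = "mix 2 bad_v bad_p \<pi> As"
  \<comment> \<open>The bound \<open>1 / 2\<close> is the common revenue, so the threshold rejects
    neither type.\<close>
  have "(\<Sum>j=1..2. ?\<alpha> j * bad_p j) \<le> 1 / 2"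
    using bad_mix[OF assms, of As] by (simp add: types_eq bad_p_def)
  moreover have "?\<alpha> j \<ge> 0" for j
    by (simp add: mix_def)
  ultimately have "threshold_run bad_v (dp_value 2 bad_lam bad_v bad_p 0 ?\<alpha>) A 0 = A"
    using dp_value_zero_capacity_diff[OF bad_p_bounds _ set_bad_lam]
    by (intro threshold_run_accept_all) (simp add: bad_v_def)
  then show ?thesis
    unfolding dpd_def
    by (simp only: objective_zero_capacity[OF bad_p_bounds])
      (simp add: types_eq bad_v_def bad_p_def)
qed

lemma bad_opt_hat:
  "real (count_list A 1) / 4 \<le> opt_hat 2 bad_v bad_p 0 A"
proof -
  \<comment> \<open>Serve exactly the profitable type; the restriction makes the vector
    extensional.\<close>
  let ?x = "\<lambda>j\<in>{1..2}. if j = 1 then count_list A j else 0"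
  have "objective 2 bad_v bad_p 0 ?x \<le> opt_hat 2 bad_v bad_p 0 A"
    by (rule opt_hat_ge) auto
  then show ?thesis
    by (simp only: objective_zero_capacity[OF bad_p_bounds])
      (simp add: types_eq bad_v_def bad_p_def)
qed

text \<open>For each outcome the loss is at least half the number of type 2 arrivals, whose mean is
  \<open>T / 2\<close>.\<close>

lemma bad_expected_loss:
  assumes "\<pi> \<ge> 1"
  shows "real T / 4 \<le> dpd_expected_loss 2 bad_lam bad_v bad_p 0 T M \<pi>"
proof -
  let ?P = "pair_pmf (arrivals bad_lam T) (replicate_pmf M (arrivals bad_lam T))"
  have fin: "finite (set_pmf (arrivals bad_lam T))"
    by (intro finite_set_arrivals) (simp add: set_bad_lam)
  then have int: "integrable (measure_pmf ?P) f" for f :: "nat list \<times> nat list list \<Rightarrow> real"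
    by (intro integrable_measure_pmf_finite)
      (simp add: set_replicate_pmf lists_eq_set finite_lists_length_eq)
  have "real T / 4 = measure_pmf.expectation (arrivals bad_lam T) (\<lambda>A. real (count_list A 2)) / 2"
    by (simp add: expectation_count_arrivals set_bad_lam pmf_bad_lam)
  \<comment> \<open>Arrivals are viewed as a marginal of the joint law, so that both expectations
    are over \<open>?P\<close>.\<close>
  also have "\<dots> = measure_pmf.expectation (map_pmf fst ?P) (\<lambda>A. real (count_list A 2) / 2)"
    by (simp add: map_fst_pair_pmf del: integral_map_pmf)
  also have "\<dots> \<le> dpd_expected_loss 2 bad_lam bad_v bad_p 0 T M \<pi>"
    unfolding dpd_expected_loss_def integral_map_pmf
  proof (intro integral_mono int)
    fix w :: "nat list \<times> nat list list"
    obtain A As where "w = (A, As)" by fastforce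
    then show "real (count_list (fst w) 2) / 2 \<le>
        (case w of (A, As) \<Rightarrow> opt_hat 2 bad_v bad_p 0 A - dpd 2 bad_lam bad_v bad_p 0 \<pi> As A)"
      using bad_opt_hat[of A] by (simp add: bad_dpd[OF assms])
  qed
  finally show ?thesis .
qed

theorem proposition3:
  fixes M :: nat
  assumes "M \<ge> 1"
  shows "\<exists>(k::nat) (lam::nat pmf) (v::nat \<Rightarrow> real) (p::nat \<Rightarrow> real) (B::nat \<Rightarrow> nat) (c::real) (T0::nat).
    valid_types k lam v p \<and>
    (\<exists>i\<in>{1..k}. \<exists>j\<in>{1..k}. p i \<noteq> p j) \<and>
    c > 0 \<and>
    (\<forall>T\<ge>T0. \<forall>\<pi>. dlp_price k lam v p (B T) T \<pi> \<longrightarrow>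
       dpd_expected_loss k lam v p (B T) T M \<pi> \<ge> c * real T)"
proof (intro exI conjI allI impI)
  show "valid_types 2 bad_lam bad_v bad_p"
    using bad_p_bounds by (simp add: valid_types_def set_bad_lam bad_v_def)
  show "\<exists>i\<in>{1..2}. \<exists>j\<in>{1..2}. bad_p i \<noteq> bad_p j"
    by (auto simp: bad_p_def)
  show "(1 / 4 :: real) > 0" by simp
  fix T :: nat and \<pi> :: real
  \<comment> \<open>This fixes \<open>T0 = 1\<close> and \<open>B\<close> constantly 0. At
    \<open>T = 0\<close> the dual objective vanishes, so even price 0 would be optimal.\<close>
  assume "T \<ge> 1" and "dlp_price 2 bad_lam bad_v bad_p 0 T \<pi>"
  then have "\<pi> \<ge> 1" by (rule bad_price_ge_1[rotated])
  from bad_expected_loss[OF this] show "1 / 4 * real T \<le> dpd_expected_loss 2 bad_lam bad_v bad_p 0 T M \<pi>"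
    by simp
qed

end
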